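(* Let $a\ge 3$ be an integer, and let $b\in(m,m+1)$ for an odd integer $m$ with $1\le m\le a-2$. Then the function $$g_{a,b}(y)=\frac{\Gamma(y+a)\,\Gamma(y+b)}{\Gamma(y)\,\Gamma(y+a+b)},\qquad y>0,$$ is not a Bernstein function.
   Context: A function $f:(0,\infty)\to[0,\infty)$ is completely monotone if $f\in C^\infty$ and $(-1)^n f^{(n)}(x)\ge 0$ for all $n\ge 0$, $x>0$. A function $g:(0,\infty)\to[0,\infty)$ is a Bernstein function if $g\in C^\infty$ and $g'$ is completely monotone. *)

theory Defs
  imports "HOL-Analysis.Analysis"
begin

text \<open>
  A function on the open half-line is represented by a total function \<open>real \<Rightarrow> real\<close>;
  only its values at positive arguments matter. Since the half-line is open,
  \<open>(deriv ^^ n) f\<close> is the \<open>n\<close>-th derivative there whenever it exists. Differentiability of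
  all iterated derivatives gives continuity of each of them, so it amounts to \<open>C\<^sup>\<infinity>\<close>.
\<close>

definition smooth_on_pos :: "(real \<Rightarrow> real) \<Rightarrow> bool" where
  "smooth_on_pos f \<longleftrightarrow> (\<forall>n. \<forall>x>0. ((deriv ^^ n) f) differentiable at x)"

definition completely_monotone :: "(real \<Rightarrow> real) \<Rightarrow> bool" where
  "completely_monotone f \<longleftrightarrow>
     (\<forall>x>0. f x \<ge> 0) \<and> smooth_on_pos f \<and>
     (\<forall>n. \<forall>x>0. (-1) ^ n * (deriv ^^ n) f x \<ge> 0)"

definition bernstein_function :: "(real \<Rightarrow> real) \<Rightarrow> bool" where
  "bernstein_function g \<longleftrightarrow>
     (\<forall>x>0. g x \<ge> 0) \<and> smooth_on_pos g \<and> completely_monotone (deriv g)"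

definition gamma_ratio :: "real \<Rightarrow> real \<Rightarrow> real \<Rightarrow> real" where
  "gamma_ratio a b y = Gamma (y + a) * Gamma (y + b) / (Gamma y * Gamma (y + a + b))"

end

theory Submission
  imports Defs
begin

text \<open>
  For an integer \<open>a = N + 1\<close> the functional equation of \<open>\<Gamma>\<close> turns the quotient into the
  rational function \<open>\<Prod>k\<le>N. (y + k) / (y + b + k)\<close>. Its poles \<open>-b - k\<close> are simple, so it
  equals \<open>c + (\<Sum>k\<le>N. R k / (y + b + k))\<close> (lemma \<open>partial_fractions_consecutive_poles\<close>).

  Differentiating \<open>n + 1\<close> times, complete monotonicity of the derivative forces
  \<open>(\<Sum>k\<le>N. R k / (y + b + k) ^ (n + 2)) \<le> 0\<close> for every \<open>n\<close>. As \<open>n\<close> grows, the pole nearest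
  to the origin dominates, hence a Bernstein function of this shape has \<open>R 0 \<le> 0\<close> (lemma
  \<open>bernstein_leading_residue_nonpos\<close>). Equivalently, by Bernstein's theorem: the function
  \<open>t \<mapsto> - t * (\<Sum>k\<le>N. R k * exp (- (b + k) * t))\<close>, whose Laplace transform is the derivative,
  would have to be nonnegative, and for large \<open>t\<close> its sign is that of \<open>- R 0\<close>.

  However, \<open>R 0 = (\<Prod>k\<le>N. k - b) / N!\<close>, and for \<open>m < b < m + 1\<close> with \<open>m \<le> N\<close> exactly the
  \<open>m + 1\<close> factors with \<open>k \<le> m\<close> are negative. As \<open>m\<close> is odd, their number is even
  and \<open>R 0 > 0\<close>.
\<close>

section \<open>Partial fractions\<close>

text \<open>
  The induction adds one factor at a time. Multiplying by
  \<open>(z + \<alpha> M) / (z + M) = 1 + (\<alpha> M - M) / (z + M)\<close> with \<open>M = N + 1\<close> multiplies the residue at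
  \<open>-k\<close> by the value \<open>(\<alpha> M - k) / (M - k)\<close> of the new factor there and creates one new pole at
  \<open>-M\<close>. For \<open>k = 0\<close> this factor is \<open>\<alpha> M / M\<close>, whence the formula for \<open>R 0\<close>.
\<close>

lemma partial_fractions_consecutive_poles:
  fixes \<alpha> :: "nat \<Rightarrow> real"
  shows "\<exists>c R. R 0 = (\<Prod>k\<le>N. \<alpha> k) / fact N \<and>
           (\<forall>z>0. (\<Prod>k\<le>N. (z + \<alpha> k) / (z + real k)) = c + (\<Sum>k\<le>N. R k / (z + real k)))"
proof (induction N)
  case 0
  have "(z + \<alpha> 0) / z = 1 + \<alpha> 0 / z" if "z > 0" for z
    using that by (simp add: field_simps)
  then show ?case
    by (intro exI[of _ "1"] exI[of _ \<alpha>]) auto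
next
  case (Suc N)
  then obtain c R where R0: "R 0 = (\<Prod>k\<le>N. \<alpha> k) / fact N"
    and R: "\<And>z. z > 0 \<Longrightarrow> (\<Prod>k\<le>N. (z + \<alpha> k) / (z + real k)) = c + (\<Sum>k\<le>N. R k / (z + real k))"
    by blast
  define M where "M = Suc N"
  define S where "S k = R k * (\<alpha> M - real k) / (real M - real k)" for k
  define T where "T = c * (\<alpha> M - real M) - (\<Sum>k\<le>N. R k * (\<alpha> M - real M) / (real M - real k))"
  define R' where "R' k = (if k = M then T else S k)" for k
  have split: "R k / (z + real k) * ((z + \<alpha> M) / (z + real M)) =
      S k / (z + real k) - R k * (\<alpha> M - real M) / (real M - real k) / (z + real M)"
    if "z > 0" "k \<le> N" for z k
  proof -
    have "z + real k > 0" "z + real M > 0" "real M - real k > 0"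
      using that by (auto simp: M_def)
    then show ?thesis
      unfolding S_def by (simp add: divide_simps) algebra
  qed
  have "(\<Prod>k\<le>Suc N. (z + \<alpha> k) / (z + real k)) = c + (\<Sum>k\<le>Suc N. R' k / (z + real k))"
    if z: "z > 0" for z
  proof -
    have "(\<Prod>k\<le>Suc N. (z + \<alpha> k) / (z + real k)) =
        (c + (\<Sum>k\<le>N. R k / (z + real k))) * ((z + \<alpha> M) / (z + real M))"
      using R[OF z] by (simp add: M_def)
    also have "\<dots> = c * ((z + \<alpha> M) / (z + real M)) +
        (\<Sum>k\<le>N. R k / (z + real k) * ((z + \<alpha> M) / (z + real M)))"
      by (simp only: distrib_right sum_distrib_right)
    also have "(\<Sum>k\<le>N. R k / (z + real k) * ((z + \<alpha> M) / (z + real M))) =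
        (\<Sum>k\<le>N. S k / (z + real k))
        - (\<Sum>k\<le>N. R k * (\<alpha> M - real M) / (real M - real k)) / (z + real M)"
      using split[OF z] by (simp add: sum_subtractf sum_divide_distrib)
    also have "c * ((z + \<alpha> M) / (z + real M)) = c + c * (\<alpha> M - real M) / (z + real M)"
      using z by (simp add: field_simps)
    also have "(\<Sum>k\<le>N. S k / (z + real k)) = (\<Sum>k\<le>N. R' k / (z + real k))"
      by (intro sum.cong) (auto simp: R'_def M_def)
    finally show ?thesis
      by (simp add: R'_def M_def T_def diff_divide_distrib)
  qed
  moreover have "R' 0 = (\<Prod>k\<le>Suc N. \<alpha> k) / fact (Suc N)"
    by (simp add: R'_def S_def R0 M_def field_simps)
  ultimately show ?case
    by blast
qed

section \<open>The pole nearest to the origin\<close>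

lemma higher_deriv_partial_fractions:
  fixes f :: "real \<Rightarrow> real"
  assumes f: "\<And>x. x > 0 \<Longrightarrow> f x = c + (\<Sum>k\<in>A. R k / (x + d k))"
    and d: "\<And>k. k \<in> A \<Longrightarrow> d k \<ge> 0" and "x > 0"
  shows "(deriv ^^ Suc n) f x = (-1) ^ Suc n * fact (Suc n) * (\<Sum>k\<in>A. R k / (x + d k) ^ (n + 2))"
  using \<open>x > 0\<close>
proof (induction n arbitrary: x)
  case 0
  have "((\<lambda>x. c + (\<Sum>k\<in>A. R k / (x + d k))) has_field_derivative
      - (\<Sum>k\<in>A. R k / (x + d k) ^ 2)) (at x)"
    using d 0 by (auto intro!: derivative_eq_intros sum.cong
        simp: power2_eq_square sum_negf[symmetric] add_pos_nonneg less_imp_neq[symmetric])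
  moreover have "eventually (\<lambda>x. c + (\<Sum>k\<in>A. R k / (x + d k)) = f x) (nhds x)"
    using eventually_nhds_in_open[of "{0<..}" x] 0 f by (auto elim!: eventually_mono)
  ultimately have "(f has_field_derivative - (\<Sum>k\<in>A. R k / (x + d k) ^ 2)) (at x)"
    by (subst (asm) DERIV_cong_ev[OF refl _ refl])
  then show ?case
    by (simp add: DERIV_imp_deriv numeral_2_eq_2)
next
  case (Suc n)
  let ?h = "\<lambda>x. (-1) ^ Suc n * fact (Suc n) * (\<Sum>k\<in>A. R k / (x + d k) ^ (n + 2))"
  have summand: "((\<lambda>x. R k / (x + d k) ^ (n + 2)) has_field_derivative
      - real (n + 2) * (R k / (x + d k) ^ (n + 3))) (at x)" if "k \<in> A" for k
  proof -
    define s where "s = x + d k"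
    have "s > 0"
      using d[OF that] Suc.prems by (simp add: s_def)
    then have "((\<lambda>x. R k / (x + d k) ^ (n + 2)) has_field_derivative
        - (R k * (real (n + 2) * s ^ (n + 1))) / (s ^ (n + 2) * s ^ (n + 2))) (at x)"
      by (auto intro!: derivative_eq_intros simp: s_def simp del: power_Suc)
    also have "- (R k * (real (n + 2) * s ^ (n + 1))) / (s ^ (n + 2) * s ^ (n + 2)) =
        - real (n + 2) * (R k / s ^ (n + 3))"
      using \<open>s > 0\<close> by (simp add: divide_simps eval_nat_numeral algebra_simps)
    finally show ?thesis
      by (simp only: s_def)
  qed
  have "(?h has_field_derivative
      (-1) ^ Suc n * fact (Suc n) * (\<Sum>k\<in>A. - real (n + 2) * (R k / (x + d k) ^ (n + 3)))) (at x)"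
    by (intro DERIV_cmult DERIV_sum summand)
  also have "(\<Sum>k\<in>A. - real (n + 2) * (R k / (x + d k) ^ (n + 3))) =
      - real (n + 2) * (\<Sum>k\<in>A. R k / (x + d k) ^ (n + 3))"
    by (simp only: sum_distrib_left)
  also have "(-1) ^ Suc n * fact (Suc n) * (- real (n + 2) * (\<Sum>k\<in>A. R k / (x + d k) ^ (n + 3))) =
      (-1) ^ Suc (Suc n) * fact (Suc (Suc n)) * (\<Sum>k\<in>A. R k / (x + d k) ^ (Suc n + 2))"
    by (simp add: algebra_simps eval_nat_numeral)
  finally have "deriv ?h x =
      (-1) ^ Suc (Suc n) * fact (Suc (Suc n)) * (\<Sum>k\<in>A. R k / (x + d k) ^ (Suc n + 2))"
    by (rule DERIV_imp_deriv)
  moreover have "deriv ((deriv ^^ Suc n) f) x = deriv ?h x"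
  proof (rule deriv_cong_ev)
    show "\<forall>\<^sub>F x in nhds x. (deriv ^^ Suc n) f x = ?h x"
      using eventually_nhds_in_open[of "{0<..}" x] Suc
      by (auto elim!: eventually_mono simp del: funpow.simps power_Suc fact_Suc)
  qed simp
  ultimately show ?case
    by simp
qed

text \<open>
  The sign conditions at the single point \<open>1\<close> suffice: in the derivative of order \<open>n + 1\<close>,
  after removing the sign \<open>(-1) ^ (n + 1)\<close> and the factorial and rescaling by \<open>(1 + b) ^ (n + 2)\<close>,
  the \<open>k\<close>-th pole contributes \<open>R k * ((1 + b) / (1 + b + k)) ^ (n + 2)\<close>, and in the limit only
  \<open>k = 0\<close> survives.
\<close>

lemma bernstein_leading_residue_nonpos:
  fixes f :: "real \<Rightarrow> real"
  assumes "bernstein_function f" and b: "b \<ge> 0"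
    and f: "\<And>x. x > 0 \<Longrightarrow> f x = c + (\<Sum>k\<le>N. R k / (x + b + real k))"
  shows "R 0 \<le> 0"
proof -
  let ?q = "\<lambda>k. (1 + b) / (1 + b + real k)"
  have scaled: "(\<Sum>k\<le>N. R k * ?q k ^ (n + 2)) \<le> 0" for n
  proof -
    have "(deriv ^^ Suc n) f 1 =
        (-1) ^ Suc n * fact (Suc n) * (\<Sum>k\<le>N. R k / (1 + (b + real k)) ^ (n + 2))"
      using f b by (intro higher_deriv_partial_fractions) (auto simp: add_ac)
    moreover have "(-1) ^ n * (deriv ^^ Suc n) f 1 \<ge> 0"
      using assms(1) by (simp add: bernstein_function_def completely_monotone_def funpow_swap1)
    ultimately have "0 \<le> - (fact (Suc n) * (\<Sum>k\<le>N. R k / (1 + (b + real k)) ^ (n + 2)))"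
      by (simp add: power_mult_distrib[symmetric] mult.assoc[symmetric] del: fact_Suc)
    then have "(\<Sum>k\<le>N. R k / (1 + (b + real k)) ^ (n + 2)) \<le> 0"
      by (metis fact_gt_zero mult_pos_pos neg_0_le_iff_le not_le)
    then have "(1 + b) ^ (n + 2) * (\<Sum>k\<le>N. R k / (1 + b + real k) ^ (n + 2)) \<le> 0"
      using b by (intro mult_nonneg_nonpos) (auto simp: add_ac)
    then show ?thesis
      by (simp add: sum_distrib_left power_divide mult.commute del: power_Suc)
  qed
  have "(\<lambda>n. R k * ?q k ^ (n + 2)) \<longlonglongrightarrow> (if k = 0 then R 0 else 0)" for k
  proof (cases "k = 0")
    case True
    then show ?thesis using b by simp
  next
    case False
    then have "(\<lambda>n. ?q k ^ n) \<longlonglongrightarrow> 0"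
      using b by (intro LIMSEQ_realpow_zero) (auto simp: divide_simps)
    from tendsto_mult_right_zero[OF LIMSEQ_ignore_initial_segment[OF this, of 2], of "R k"]
    show ?thesis using False by simp
  qed
  then have "(\<lambda>n. \<Sum>k\<le>N. R k * ?q k ^ (n + 2)) \<longlonglongrightarrow> (\<Sum>k\<le>N. if k = 0 then R 0 else 0)"
    by (intro tendsto_sum)
  then have "(\<lambda>n. \<Sum>k\<le>N. R k * ?q k ^ (n + 2)) \<longlonglongrightarrow> R 0"
    by simp
  then show ?thesis
    using scaled by (intro LIMSEQ_le_const2) auto
qed

section \<open>The Gamma quotient\<close>

lemma gamma_ratio_of_nat_eq_prod:
  assumes "y > 0" "b \<ge> 0"
  shows "gamma_ratio (real n) b y = (\<Prod>k<n. (y + real k) / (y + b + real k))"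
proof -
  have "y \<notin> \<int>\<^sub>\<le>\<^sub>0" "y + b \<notin> \<int>\<^sub>\<le>\<^sub>0"
    using assms by (auto elim!: nonpos_Ints_cases)
  then have "pochhammer y n / pochhammer (y + b) n = gamma_ratio (real n) b y"
    by (simp add: pochhammer_Gamma gamma_ratio_def add_ac)
  then show ?thesis
    by (simp add: pochhammer_prod prod_dividef atLeast0LessThan)
qed

lemma prod_of_nat_minus_pos:
  fixes b :: real
  assumes "odd m" "m \<le> N" "real m < b" "b < real m + 1"
  shows "(\<Prod>k\<le>N. real k - b) > 0"
proof -
  have "(\<Prod>k\<le>m. real k - b) = (\<Prod>k\<le>m. - 1 * (b - real k))"
    by simp
  also have "\<dots> = (-1) ^ Suc m * (\<Prod>k\<le>m. b - real k)"
    by (subst prod.distrib) simp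
  also have "\<dots> = (\<Prod>k\<le>m. b - real k)"
    using \<open>odd m\<close> by simp
  also have "\<dots> > 0"
    using assms by (intro prod_pos) auto
  finally have "(\<Prod>k\<le>m. real k - b) > 0" .
  moreover have "(\<Prod>k\<in>{m<..N}. real k - b) > 0"
  proof (intro prod_pos)
    fix k assume "k \<in> {m<..N}"
    then have "real m + 1 \<le> real k" by auto
    then show "0 < real k - b" using assms by linarith
  qed
  moreover have "{..N} = {..m} \<union> {m<..N}"
    using \<open>m \<le> N\<close> by auto
  then have "(\<Prod>k\<le>N. real k - b) = (\<Prod>k\<le>m. real k - b) * (\<Prod>k\<in>{m<..N}. real k - b)"
    by (simp only:) (intro prod.union_disjoint; auto)
  ultimately show ?thesis
    by simp
qed

theorem proposition4p5:
  fixes a m :: int and b :: real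
  assumes "a \<ge> 3"
    and "odd m" and "1 \<le> m" and "m \<le> a - 2"
    and "b \<in> {of_int m<..<of_int m + 1}"
  shows "\<not> bernstein_function (gamma_ratio (of_int a) b)"
proof
  assume bern: "bernstein_function (gamma_ratio (of_int a) b)"
  define N where "N = nat (a - 1)"
  define j where "j = nat m"
  have a: "real_of_int a = real (Suc N)"
    using assms by (simp add: N_def)
  have m: "m = int j"
    using assms by (simp add: j_def)
  have j: "odd j" "j \<le> N" "real j < b" "b < real j + 1"
    using assms m by (auto simp: N_def)
  have b: "b > 0"
    using j by linarith
  obtain c R where R0: "R 0 = (\<Prod>k\<le>N. real k - b) / fact N"
    and R: "\<And>z. z > 0 \<Longrightarrow>
      (\<Prod>k\<le>N. (z + (real k - b)) / (z + real k)) = c + (\<Sum>k\<le>N. R k / (z + real k))"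
    using partial_fractions_consecutive_poles[where \<alpha> = "\<lambda>k. real k - b" and N = N] by blast
  have "gamma_ratio (of_int a) b y = c + (\<Sum>k\<le>N. R k / (y + b + real k))" if "y > 0" for y
  proof -
    have "gamma_ratio (of_int a) b y = (\<Prod>k\<le>N. (y + real k) / (y + b + real k))"
      unfolding a using that b by (simp only: gamma_ratio_of_nat_eq_prod lessThan_Suc_atMost)
    then show ?thesis
      using R[of "y + b"] that b by (simp add: algebra_simps)
  qed
  then have "R 0 \<le> 0"
    using bernstein_leading_residue_nonpos[OF bern less_imp_le[OF b]] by blast
  moreover have "R 0 > 0"
    unfolding R0 using prod_of_nat_minus_pos[OF j] by simp
  ultimately show False
    by simp
qed

end
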